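(* Let $n,m,d\in\mathbb{N}$ with $d\ge3$ and $n\ge3$. Every oracle comparator circuit computing $y=f[A^1,\dots,A^m]$ (correctly for all choices of the oracles $a^k_i$) has at least $\min\bigl(2^n,(d-2)^{m-1}\bigr)$ gates.
   Context: For each $k\in[m]$ and $i\in[n]$, $a^k_i:\{0,1\}^{dn}\to\{0,1\}$ is a Boolean oracle, and $A^k=(a^k_1,\dots,a^k_n)$. Define $x^{m+1}_i=0$ for $i\in[n]$; $x^k_i=a^k_i(x^{k+1}_1,\dots,x^{k+1}_1,\dots,x^{k+1}_n,\dots,x^{k+1}_n)$, where each $x^{k+1}_j$ is repeated $d$ times, for $k\in[m]$, $i\in[n]$; and $y=f[A^1,\dots,A^m]=x^1_1\oplus\cdots\oplus x^1_n$. An oracle comparator circuit consists of wires initialized with constants, a designated output wire, and a sequence of gates, each being a comparator gate (mapping values $(p,q)$ on two wires to $(p\wedge q,p\vee q)$), a negation gate on one wire, or an oracle gate $a^k_i$; an oracle gate takes $dn$ distinct wires as inputs and writes $dn$ outputs onto $dn$ distinct wires, the first output being the value of $a^k_i$ and the remaining $dn-1$ outputs being identically $0$. *)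

theory Defs
  imports Main
begin

text \<open>
  Boolean values are \<^typ>\<open>bool\<close>.  A family of oracles is a function \<open>a\<close>, where \<open>a k i\<close> stands for
  $a^k_i$ and is only ever applied to lists of length \<open>d * n\<close>.
\<close>

type_synonym oracles = "nat \<Rightarrow> nat \<Rightarrow> bool list \<Rightarrow> bool"

definition repeat_inputs :: "nat \<Rightarrow> nat \<Rightarrow> (nat \<Rightarrow> bool) \<Rightarrow> bool list" where
  "repeat_inputs d n x = concat (map (\<lambda>j. replicate d (x j)) [1..<Suc n])"

text \<open>
  \<open>layer_value d n m a k i\<close> is $x^k_i$.  The recursion descends from \<open>k = m + 1\<close>, where all values
  are 0.
\<close>

function layer_value :: "nat \<Rightarrow> nat \<Rightarrow> nat \<Rightarrow> oracles \<Rightarrow> nat \<Rightarrow> nat \<Rightarrow> bool" where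
  "layer_value d n m a k i =
     (if m < k then False
      else a k i (repeat_inputs d n (\<lambda>j. layer_value d n m a (Suc k) j)))"
  by pat_completeness auto
termination
  by (relation "measure (\<lambda>(d, n, m, a, k, i). Suc m - k)") auto

declare layer_value.simps [simp del]

definition iterated_fun :: "nat \<Rightarrow> nat \<Rightarrow> nat \<Rightarrow> oracles \<Rightarrow> bool" where
  "iterated_fun d n m a =
     foldr (\<lambda>p q. p \<noteq> q) (map (layer_value d n m a 1) [1..<Suc n]) False"

text \<open>
  \<open>Oracle k i us vs\<close> is a gate $a^k_i$ with input wires \<open>us\<close> and output wires \<open>vs\<close>, in this order.
\<close>

datatype gate =
    Comparator nat nat
  | Negation nat
  | Oracle nat nat "nat list" "nat list"

record circuit =
  wires :: nat
  init :: "nat \<Rightarrow> bool"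
  gates :: "gate list"
  out_wire :: nat

fun wf_gate :: "nat \<Rightarrow> nat \<Rightarrow> nat \<Rightarrow> nat \<Rightarrow> gate \<Rightarrow> bool" where
  "wf_gate d n m w (Comparator u v) \<longleftrightarrow> u < w \<and> v < w \<and> u \<noteq> v"
| "wf_gate d n m w (Negation u) \<longleftrightarrow> u < w"
| "wf_gate d n m w (Oracle k i us vs) \<longleftrightarrow>
     k \<in> {1..m} \<and> i \<in> {1..n} \<and>
     length us = d * n \<and> distinct us \<and> set us \<subseteq> {..<w} \<and>
     length vs = d * n \<and> distinct vs \<and> set vs \<subseteq> {..<w}"

definition wf_circuit :: "nat \<Rightarrow> nat \<Rightarrow> nat \<Rightarrow> circuit \<Rightarrow> bool" where
  "wf_circuit d n m C \<longleftrightarrow>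
     out_wire C < wires C \<and> (\<forall>g \<in> set (gates C). wf_gate d n m (wires C) g)"

text \<open>
  Gates consume their inputs: comparator circuits have no fan-out.  Usually the output wires of an
  oracle gate are its input wires; an input wire that is not also an output wire carries 0
  afterwards.  If it kept its old value, an oracle gate would copy signals for free, and
  \<open>d * n * m\<close> oracle gates would suffice to make \<open>d\<close> copies of every $x^k_i$.
\<close>

fun apply_gate :: "oracles \<Rightarrow> gate \<Rightarrow> (nat \<Rightarrow> bool) \<Rightarrow> (nat \<Rightarrow> bool)" where
  "apply_gate a (Comparator u v) s = s(u := (s u \<and> s v), v := (s u \<or> s v))"
| "apply_gate a (Negation u) s = s(u := (\<not> s u))"
| "apply_gate a (Oracle k i us vs) s =
     (\<lambda>w. if w \<in> set vs then w = hd vs \<and> a k i (map s us)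
          else if w \<in> set us then False
          else s w)"

definition circuit_value :: "oracles \<Rightarrow> circuit \<Rightarrow> bool" where
  "circuit_value a C = fold (apply_gate a) (gates C) (init C) (out_wire C)"

end

theory Submission
  imports Defs
begin

text \<open>
  Fix secret vectors $u^2,\dots,u^m$ and let $u^{m+1} = 0$. The oracles answer $u^l_i$ on the repetition of
  $u^{l+1}$ and 0 everywhere else; in the $k$-th run, all layers up to $k$ are moreover silenced
  (constantly 0). Let $N_k$ be the number of layer-$k$ gates that are fed the repetition of
  $u^{k+1}$ in the $k$-th run. The output depends on every $a^1_i$ at that point, so $N_1 \ge n$.

  Now compare runs $k$ and $k+1$. A comparator, a negation or an oracle gate never increases the
  number of wires on which the two runs differ, except that each of the $N_{k+1}$ gates
  can create one difference. A layer-$k$ gate that is fed the repetition of $u^{k+1}$ in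
  run $k$ destroys at least $d$ differences, unless in run $k+1$ its input happens to have
  distance less than $d$ to that repetition. Call such a gate lucky; if there are $L_k$ lucky gates,
  then $d N_k \le N_{k+1} + d L_k$.

  Run $k+1$ does not depend on $u^{k+1}$. If $u^{k+1}$ is taken from the $2^{n-1}$ vectors of
  even parity, then the repetitions are at distance at least $2d$ from each other, so every gate is lucky for at
  most one choice. Choosing $u^m, u^{m-1}, \dots, u^2$ in this order by averaging, fewer
  than $2^n$ gates leave at most one lucky gate in total, and $N_m \ge (n-1) d^{m-1}$.
\<close>

section \<open>Hamming distance, repeated vectors and the even-parity code\<close>

definition hdist :: "bool list \<Rightarrow> bool list \<Rightarrow> nat" where
  "hdist xs ys = length (filter (\<lambda>(x, y). x \<noteq> y) (zip xs ys))"

lemma hdist_commute: "hdist xs ys = hdist ys xs"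
  unfolding hdist_def
  by (induction xs ys rule: list_induct2') auto

lemma hdist_triangle:
  assumes "length xs = length ys" "length ys = length zs"
  shows "hdist xs zs \<le> hdist xs ys + hdist ys zs"
  using assms unfolding hdist_def
  by (induction xs ys zs rule: list_induct3) auto

lemma hdist_append:
  "length xs = length ys \<Longrightarrow> hdist (xs @ xs') (ys @ ys') = hdist xs ys + hdist xs' ys'"
  by (simp add: hdist_def)

lemma hdist_replicate: "hdist (replicate d x) (replicate d y) = (if x = y then 0 else d)"
  by (induction d) (auto simp: hdist_def)

lemma hdist_map:
  assumes "distinct us"
  shows "hdist (map s us) (map t us) = card {w \<in> set us. s w \<noteq> t w}"
proof -
  have "hdist (map s us) (map t us) = length (filter (\<lambda>w. s w \<noteq> t w) us)"
    unfolding hdist_def by (induction us) auto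
  also have "\<dots> = card (set (filter (\<lambda>w. s w \<noteq> t w) us))"
    using assms by (metis distinct_card distinct_filter)
  finally show ?thesis by simp
qed

lemma length_repeat_inputs: "length (repeat_inputs d n x) = d * n"
proof -
  have "length (concat (map (\<lambda>j. replicate d (x j)) js)) = d * length js" for js :: "nat list"
    by (induction js) auto
  then show ?thesis by (simp add: repeat_inputs_def del: upt_Suc)
qed

lemma hdist_repeat_inputs:
  "hdist (repeat_inputs d n x) (repeat_inputs d n y) = d * card {j \<in> {1..n}. x j \<noteq> y j}"
proof -
  have "hdist (concat (map (\<lambda>j. replicate d (x j)) js)) (concat (map (\<lambda>j. replicate d (y j)) js))
      = d * card {j \<in> set js. x j \<noteq> y j}" if "distinct js" for js :: "nat list"
    using that
  proof (induction js)
    case Nil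
    then show ?case by (simp add: hdist_def)
  next
    case (Cons k js)
    have "{j \<in> set (k # js). x j \<noteq> y j} =
        (if x k = y k then {j \<in> set js. x j \<noteq> y j} else insert k {j \<in> set js. x j \<noteq> y j})"
      by auto
    with Cons show ?case
      by (simp add: hdist_append hdist_replicate)
  qed
  from this[of "[1..<Suc n]"] show ?thesis
    by (simp add: repeat_inputs_def atLeastLessThanSuc_atLeastAtMost del: upt_Suc)
qed

text \<open>For \<open>A\<close> \<subseteq> \<open>{1..<n}\<close>, entry \<open>n\<close> is the
  parity bit that makes the weight even.\<close>

definition parity_vec :: "nat \<Rightarrow> nat set \<Rightarrow> nat \<Rightarrow> bool" where
  "parity_vec n A j = (if j = n then odd (card A) else j \<in> A)"

lemma hdist_parity_vec:
  assumes A: "A \<subseteq> {1..<n}" and B: "B \<subseteq> {1..<n}" and "A \<noteq> B"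
  shows "hdist (repeat_inputs d n (parity_vec n A)) (repeat_inputs d n (parity_vec n B)) \<ge> 2 * d"
proof -
  let ?S = "{j \<in> {1..n}. parity_vec n A j \<noteq> parity_vec n B j}"
  have differs: "j \<in> ?S" if "(j \<in> A) \<noteq> (j \<in> B)" for j
    using that A B by (fastforce simp: parity_vec_def)
  obtain j where j: "(j \<in> A) \<noteq> (j \<in> B)"
    using \<open>A \<noteq> B\<close> by auto
  have fin: "finite A" "finite B"
    using A B by (auto intro: finite_subset)
  have "j < n"
    using j A B by auto
  obtain i where i: "i \<in> ?S" "i \<noteq> j"
  proof (cases "\<exists>i. i \<noteq> j \<and> (i \<in> A) \<noteq> (i \<in> B)")
    case True
    then show ?thesis using differs that by blast
  next
    case False
    then have "i \<in> A \<longleftrightarrow> i \<in> B" if "i \<noteq> j" for i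
      using that by blast
    \<comment> \<open>If \<open>j\<close> is the only difference, the sizes of \<open>A\<close> and
      \<open>B\<close> differ by one, so the parity bit at \<open>n\<close> is the second differing
      position.\<close>
    then have "A = insert j B \<and> j \<notin> B \<or> B = insert j A \<and> j \<notin> A"
      using j unfolding set_eq_iff insert_iff by metis
    then have "odd (card A) \<noteq> odd (card B)"
      using fin by auto
    then have "n \<in> ?S"
      using \<open>j < n\<close> by (auto simp: parity_vec_def)
    then show ?thesis
      using that \<open>j < n\<close> by blast
  qed
  have "card {i, j} \<le> card ?S"
    using i differs[OF j] by (intro card_mono) auto
  then have "2 \<le> card ?S"
    using \<open>i \<noteq> j\<close> by simp
  then show ?thesis
    unfolding hdist_repeat_inputs by (simp add: mult.commute)
qed

section \<open>Counting gates along a run\<close>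

fun run_count :: "oracles \<Rightarrow> (gate \<Rightarrow> (nat \<Rightarrow> bool) \<Rightarrow> bool) \<Rightarrow> gate list \<Rightarrow> (nat \<Rightarrow> bool) \<Rightarrow> nat"
  where
  "run_count a P [] s = 0"
| "run_count a P (g # gs) s = of_bool (P g s) + run_count a P gs (apply_gate a g s)"

lemma run_count_le_length: "run_count a P gs s \<le> length gs"
proof (induction gs arbitrary: s)
  case (Cons g gs)
  from Cons[of "apply_gate a g s"] show ?case by simp
qed simp

text \<open>All the counts follow the same sequence of states, so the hypothesis can be added up
  gate by gate. It is applied to predicates that exclude each other.\<close>

lemma sum_run_count_le:
  assumes "\<And>g s. g \<in> set gs \<Longrightarrow> (\<Sum>i\<in>I. of_bool (P i g s)) \<le> (of_bool (Q g s) :: nat)"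
  shows "(\<Sum>i\<in>I. run_count a (P i) gs s) \<le> run_count a Q gs s"
  using assms
proof (induction gs arbitrary: s)
  case (Cons g gs)
  have "(\<Sum>i\<in>I. run_count a (P i) gs (apply_gate a g s)) \<le> run_count a Q gs (apply_gate a g s)"
    using Cons by simp
  moreover have "(\<Sum>i\<in>I. of_bool (P i g s)) \<le> (of_bool (Q g s) :: nat)"
    using Cons.prems by simp
  ultimately show ?case
    by (simp add: sum.distrib)
qed simp

lemma sum_of_bool_le_of_bool:
  assumes "\<And>i. i \<in> I \<Longrightarrow> P i \<Longrightarrow> Q"
    and "\<And>i j. i \<in> I \<Longrightarrow> j \<in> I \<Longrightarrow> P i \<Longrightarrow> P j \<Longrightarrow> i = j"
  shows "(\<Sum>i\<in>I. of_bool (P i)) \<le> (of_bool Q :: nat)"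
proof (cases "\<exists>i\<in>I. P i")
  case True
  then obtain i where i: "i \<in> I" "P i" by blast
  have "(\<Sum>j\<in>I. of_bool (P j)) = (\<Sum>j\<in>I. if j = i then 1 else 0 :: nat)"
    using i assms(2) by (intro sum.cong) auto
  also have "\<dots> \<le> 1"
    by (cases "finite I") auto
  finally show ?thesis
    using assms(1)[OF i] by simp
qed simp

fun in_layer :: "nat \<Rightarrow> gate \<Rightarrow> bool" where
  "in_layer k (Oracle l i us vs) \<longleftrightarrow> l = k"
| "in_layer k _ \<longleftrightarrow> False"

text \<open>\<open>I = UNIV\<close> gives the counts \<open>N_k\<close>; singletons separate the
  oracles of the first layer.\<close>

fun fed :: "nat \<Rightarrow> nat set \<Rightarrow> bool list \<Rightarrow> gate \<Rightarrow> (nat \<Rightarrow> bool) \<Rightarrow> bool" where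
  "fed k I z (Oracle l i us vs) s \<longleftrightarrow> l = k \<and> i \<in> I \<and> map s us = z"
| "fed k I z _ s \<longleftrightarrow> False"

text \<open>These are the lucky gates when evaluated in run \<open>k + 1\<close>. The radius
  \<open>d\<close> is half the minimum distance of repeated even-parity vectors, so the open balls
  around them are disjoint.\<close>

fun nearly_fed :: "nat \<Rightarrow> nat \<Rightarrow> bool list \<Rightarrow> gate \<Rightarrow> (nat \<Rightarrow> bool) \<Rightarrow> bool" where
  "nearly_fed d k z (Oracle l i us vs) s \<longleftrightarrow> l = k \<and> hdist (map s us) z < d"
| "nearly_fed d k z _ s \<longleftrightarrow> False"

text \<open>The two oracle families can disagree only at a point that is never queried, so all
  states coincide.\<close>

lemma run_cong_if_never_fed:
  assumes "run_count a (fed k {i} z) gs s = 0"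
    and "\<And>l j v. (l, j, v) \<noteq> (k, i, z) \<Longrightarrow> a' l j v = a l j v"
  shows "fold (apply_gate a') gs s = fold (apply_gate a) gs s"
  using assms(1)
proof (induction gs arbitrary: s)
  case (Cons g gs)
  have "apply_gate a' g s = apply_gate a g s"
    using Cons.prems assms(2) by (cases g) (auto simp: fun_eq_iff split: if_splits)
  then show ?case
    using Cons by simp
qed simp

section \<open>Effect of a gate on the set of wires where two runs differ\<close>

definition diff_wires :: "nat \<Rightarrow> (nat \<Rightarrow> bool) \<Rightarrow> (nat \<Rightarrow> bool) \<Rightarrow> nat set" where
  "diff_wires W s t = {w. w < W \<and> s w \<noteq> t w}"

lemma finite_diff_wires [simp]: "finite (diff_wires W s t)"
  by (simp add: diff_wires_def)

text \<open>Only two wires change, and sorting two bits does not increase Hamming distance, by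
  checking the 16 cases.\<close>

lemma card_diff_wires_comparator:
  assumes "u < W" "v < W" "u \<noteq> v"
  shows "card (diff_wires W (apply_gate a (Comparator u v) s) (apply_gate b (Comparator u v) t))
    \<le> card (diff_wires W s t)"
proof -
  have split: "diff_wires W s' t' = {w. w < W \<and> w \<noteq> u \<and> w \<noteq> v \<and> s' w \<noteq> t' w} \<union>
      ((if s' u \<noteq> t' u then {u} else {}) \<union> (if s' v \<noteq> t' v then {v} else {}))" for s' t'
    using assms by (auto simp: diff_wires_def)
  have card: "card (diff_wires W s' t') = card {w. w < W \<and> w \<noteq> u \<and> w \<noteq> v \<and> s' w \<noteq> t' w} +
      (of_bool (s' u \<noteq> t' u) + of_bool (s' v \<noteq> t' v))" for s' t'
    using assms by (subst split, subst card_Un_disjoint) auto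
  let ?s = "apply_gate a (Comparator u v) s" and ?t = "apply_gate b (Comparator u v) t"
  have "{w. w < W \<and> w \<noteq> u \<and> w \<noteq> v \<and> ?s w \<noteq> ?t w} =
      {w. w < W \<and> w \<noteq> u \<and> w \<noteq> v \<and> s w \<noteq> t w}"
    by (rule Collect_cong) auto
  moreover have "of_bool (?s u \<noteq> ?t u) + of_bool (?s v \<noteq> ?t v) \<le>
      (of_bool (s u \<noteq> t u) + of_bool (s v \<noteq> t v) :: nat)"
    using assms(3) by (cases "s u"; cases "s v"; cases "t u"; cases "t v") simp_all
  ultimately show ?thesis
    unfolding card[of ?s ?t] card[of s t] by simp
qed

lemma card_diff_wires_negation:
  "card (diff_wires W (apply_gate a (Negation u) s) (apply_gate b (Negation u) t)) =
    card (diff_wires W s t)"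
  by (rule arg_cong[where f = card]) (auto simp: diff_wires_def)

text \<open>Input wires are overwritten or reset to 0, so all differences on them are destroyed;
  only \<open>hd vs\<close> can carry a new one.\<close>

lemma card_diff_wires_oracle:
  assumes "distinct us" "set us \<subseteq> {..<W}"
  shows "card (diff_wires W (apply_gate a (Oracle l i us vs) s) (apply_gate b (Oracle l i us vs) t))
      + hdist (map s us) (map t us)
    \<le> card (diff_wires W s t) + of_bool (a l i (map s us) \<noteq> b l i (map t us))"
    (is "card ?D + _ \<le> _ + of_bool ?o")
proof -
  let ?U = "{w \<in> set us. s w \<noteq> t w}"
  have "?D \<subseteq> (diff_wires W s t - ?U) \<union> (if ?o then {hd vs} else {})"
    by (auto simp: diff_wires_def split: if_splits)
  then have "card ?D \<le> card ((diff_wires W s t - ?U) \<union> (if ?o then {hd vs} else {}))"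
    by (rule card_mono[rotated]) simp
  also have "\<dots> \<le> card (diff_wires W s t - ?U) + card (if ?o then {hd vs} else {})"
    by (rule card_Un_le)
  also have "card (if ?o then {hd vs} else {}) = of_bool ?o"
    by simp
  finally have "card ?D \<le> card (diff_wires W s t - ?U) + of_bool ?o" .
  moreover have "?U \<subseteq> diff_wires W s t"
    using assms by (auto simp: diff_wires_def)
  then have "card (diff_wires W s t - ?U) + card ?U = card (diff_wires W s t)"
    using card_Diff_subset[of ?U "diff_wires W s t"] card_mono[of "diff_wires W s t" ?U] by simp
  ultimately show ?thesis
    using hdist_map[OF assms(1), of s t] by linarith
qed

section \<open>Secret oracles and the comparison of consecutive runs\<close>

definition secret_oracle :: "nat \<Rightarrow> nat \<Rightarrow> (nat \<Rightarrow> nat \<Rightarrow> bool) \<Rightarrow> nat \<Rightarrow> oracles" where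
  "secret_oracle d n u k = (\<lambda>l i z. k < l \<and> z = repeat_inputs d n (u (Suc l)) \<and> u l i)"

text \<open>Run \<open>k\<close> reads only secrets of index above \<open>k\<close>, so
  \<open>u k\<close> may be chosen after run \<open>k\<close> is fixed.\<close>

lemma secret_oracle_cong:
  assumes "\<And>l. k < l \<Longrightarrow> u l = v l"
  shows "secret_oracle d n u k = secret_oracle d n v k"
proof (intro ext)
  fix l i z
  show "secret_oracle d n u k l i z = secret_oracle d n v k l i z"
    using assms[of l] assms[of "Suc l"] by (cases "k < l") (auto simp: secret_oracle_def)
qed

text \<open>Descending from layer \<open>m + 1\<close>, each layer receives the secret that unlocks
  its own. Layer 1 is left arbitrary so that the result also covers an oracle modified
  there.\<close>

lemma layer_value_secret:
  assumes a: "\<And>l. 1 < l \<Longrightarrow> a l = secret_oracle d n u 1 l"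
    and u: "u (Suc m) = (\<lambda>_. False)"
    and k: "1 < k" "k \<le> Suc m"
  shows "layer_value d n m a k = u k"
  using k(2,1)
proof (induction k rule: inc_induct)
  case base
  show ?case by (simp add: u layer_value.simps fun_eq_iff)
next
  case (step k)
  then show ?case
    by (subst fun_eq_iff, subst layer_value.simps) (auto simp: a secret_oracle_def)
qed

lemma foldr_xor_split:
  "foldr (\<lambda>p q. p \<noteq> q) (xs @ p # ys) False \<noteq> foldr (\<lambda>p q. p \<noteq> q) (xs @ (\<not> p) # ys) False"
  by (induction xs) auto

lemma iterated_fun_flip:
  assumes "i \<in> {1..n}"
    and flip: "\<And>j. j \<noteq> i \<Longrightarrow> layer_value d n m a' 1 j = layer_value d n m a 1 j"
      "layer_value d n m a' 1 i \<noteq> layer_value d n m a 1 i"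
  shows "iterated_fun d n m a' \<noteq> iterated_fun d n m a"
proof -
  obtain xs ys where split: "[1..<Suc n] = xs @ i # ys"
    using assms(1) split_list[of i "[1..<Suc n]"] by (auto simp del: upt_Suc)
  then have "i \<notin> set xs" "i \<notin> set ys"
    using distinct_upt[of 1 "Suc n"] by (auto simp del: upt_Suc distinct_upt)
  then have maps: "map (layer_value d n m a' 1) xs = map (layer_value d n m a 1) xs"
    "map (layer_value d n m a' 1) ys = map (layer_value d n m a 1) ys"
    by - (rule map_cong[OF refl flip(1)]; blast)+
  have neg: "layer_value d n m a' 1 i = (\<not> layer_value d n m a 1 i)"
    using flip(2) by blast
  show ?thesis
    unfolding iterated_fun_def split map_append list.map maps neg
    by (rule foldr_xor_split[symmetric])
qed

text \<open>Otherwise changing the oracle at this one point would leave the run unaltered, yet flip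
  one summand of the XOR.\<close>

lemma fed_first_layer:
  assumes "m \<ge> 1" and i: "i \<in> {1..n}"
    and correct: "\<And>a. circuit_value a C = iterated_fun d n m a"
    and u: "u (Suc m) = (\<lambda>_. False)"
  shows "run_count (secret_oracle d n u 1) (fed 1 {i} (repeat_inputs d n (u 2))) (gates C) (init C)
    \<ge> 1"
proof (rule ccontr)
  let ?z = "repeat_inputs d n (u 2)"
  let ?a = "secret_oracle d n u 1"
  \<comment> \<open>Layer 1 is silent in run 1, so the answer \<open>True\<close> is a genuine
    change.\<close>
  define a' where "a' = (\<lambda>l j v. if (l, j, v) = (1, i, ?z) then True else ?a l j v)"
  assume "\<not> ?thesis"
  then have "run_count ?a (fed 1 {i} ?z) (gates C) (init C) = 0"
    by simp
  then have "circuit_value a' C = circuit_value ?a C"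
    unfolding circuit_value_def
    by (subst run_cong_if_never_fed[where a = ?a]) (auto simp: a'_def)
  then have same: "iterated_fun d n m a' = iterated_fun d n m ?a"
    using correct by simp
  have a': "a' l = secret_oracle d n u 1 l" if "1 < l" for l
    using that by (simp add: a'_def fun_eq_iff)
  \<comment> \<open>Layers above 1 are unmodified, so both oracles evaluate layer 1 at
    \<open>?z\<close>.\<close>
  have "layer_value d n m a' 2 = u 2" "layer_value d n m ?a 2 = u 2"
    using \<open>m \<ge> 1\<close> by (intro layer_value_secret[where u = u] a' u; simp)+
  moreover have "layer_value d n m b 1 j = b 1 j (repeat_inputs d n (layer_value d n m b 2))" for b j
    using \<open>m \<ge> 1\<close> layer_value.simps[of d n m b 1 j] by (simp add: numeral_2_eq_2)
  ultimately have "layer_value d n m a' 1 j = a' 1 j ?z" "layer_value d n m ?a 1 j = ?a 1 j ?z" for j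
    by metis+
  then have "iterated_fun d n m a' \<noteq> iterated_fun d n m ?a"
    by (intro iterated_fun_flip[OF i]) (simp_all add: a'_def secret_oracle_def del: One_nat_def)
  with same show False by simp
qed

text \<open>Amortization with the number of differing wires as potential: \<open>s\<close> evolves
  in run \<open>k\<close> and \<open>t\<close> in run \<open>k + 1\<close>. The inequality
  \<open>step\<close> for a single gate telescopes.\<close>

lemma flip_balance:
  fixes d n :: nat and u :: "nat \<Rightarrow> nat \<Rightarrow> bool"
  defines "a \<equiv> secret_oracle d n u"
    and "z \<equiv> \<lambda>k. repeat_inputs d n (u (Suc k))"
  assumes "\<And>g. g \<in> set gs \<Longrightarrow> wf_gate d n m W g"
  shows "d * run_count (a k) (fed k UNIV (z k)) gs s
    \<le> card (diff_wires W s t) + run_count (a (Suc k)) (fed (Suc k) UNIV (z (Suc k))) gs t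
      + d * run_count (a (Suc k)) (nearly_fed d k (z k)) gs t"
  using assms(3)
proof (induction gs arbitrary: s t)
  case (Cons g gs)
  let ?s = "apply_gate (a k) g s" and ?t = "apply_gate (a (Suc k)) g t"
  have wf: "wf_gate d n m W g"
    using Cons.prems by simp
  have step: "card (diff_wires W ?s ?t) + d * of_bool (fed k UNIV (z k) g s)
    \<le> card (diff_wires W s t) + of_bool (fed (Suc k) UNIV (z (Suc k)) g t)
      + d * of_bool (nearly_fed d k (z k) g t)"
  proof (cases g)
    case (Comparator u v)
    then show ?thesis
      using wf card_diff_wires_comparator[of u W v "a k" s "a (Suc k)" t] by simp
  next
    case (Negation u)
    then show ?thesis
      using card_diff_wires_negation[of W "a k" u s "a (Suc k)" t] by simp
  next
    case (Oracle l i us vs)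
    let ?h = "hdist (map s us) (map t us)"
    let ?o = "a k l i (map s us) \<noteq> a (Suc k) l i (map t us)"
    have us: "distinct us" "set us \<subseteq> {..<W}"
      using wf Oracle by auto
    have change: "card (diff_wires W ?s ?t) + ?h \<le> card (diff_wires W s t) + of_bool ?o"
      unfolding Oracle by (rule card_diff_wires_oracle[OF us])
    have h0: "map s us = map t us" if "?h = 0"
      using that us by (simp add: hdist_map)
    have fed: "fed j UNIV v g s' \<longleftrightarrow> l = j \<and> map s' us = v"
      and near: "nearly_fed d j v g s' \<longleftrightarrow> l = j \<and> hdist (map s' us) v < d" for j v s'
      by (simp_all add: Oracle)
    consider "l = k" | "l = Suc k" | "l \<noteq> k" "l \<noteq> Suc k" by blast
    then show ?thesis
    proof cases
      case 1
      \<comment> \<open>Layer \<open>k\<close> is silent in both runs, so no difference arises. A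
        gate fed in run \<open>k\<close> and not lucky destroys at least \<open>d\<close>
        differences.\<close>
      then have "\<not> ?o" by (simp add: a_def secret_oracle_def)
      then show ?thesis
        using change 1 hdist_commute[of "map s us" "map t us"]
        by (auto simp: fed near)
    next
      case 2
      \<comment> \<open>Layer \<open>k + 1\<close> answers only in run \<open>k\<close>. A new
        difference is paid for by a destroyed input difference, or the inputs agree and the gate is
        also fed in run \<open>k + 1\<close>.\<close>
      then have "map s us = z (Suc k)" if ?o
        using that by (auto simp: a_def z_def secret_oracle_def)
      then have "of_bool ?o \<le> ?h + of_bool (fed (Suc k) UNIV (z (Suc k)) g t)"
        using h0 2 by (cases "?h = 0") (auto simp: fed)
      then show ?thesis
        using change 2 by (simp add: fed near)
    next
      case 3
      \<comment> \<open>All other layers answer alike in both runs, so an output difference requires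
        an input difference, which is destroyed.\<close>
      then have "a k l = a (Suc k) l"
        by (auto simp: a_def secret_oracle_def fun_eq_iff)
      then have "of_bool ?o \<le> ?h"
        using h0 by (cases "?h = 0") (simp_all del: map_eq_conv)
      then show ?thesis
        using change 3 by (simp add: fed near)
    qed
  qed
  have "d * run_count (a k) (fed k UNIV (z k)) gs ?s
    \<le> card (diff_wires W ?s ?t) + run_count (a (Suc k)) (fed (Suc k) UNIV (z (Suc k))) gs ?t
      + d * run_count (a (Suc k)) (nearly_fed d k (z k)) gs ?t"
    using Cons by simp
  with step show ?case
    by (simp only: run_count.simps distrib_left)
qed simp

section \<open>Choosing the secrets by averaging\<close>

lemma run_count_in_layer:
  "run_count a (\<lambda>g s. in_layer k g) gs s = length (filter (in_layer k) gs)"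
  by (induction gs arbitrary: s) auto

lemma sum_length_filter_in_layer: "(\<Sum>k\<in>K. length (filter (in_layer k) gs)) \<le> length gs"
proof (induction gs)
  case (Cons g gs)
  have "in_layer k g \<Longrightarrow> in_layer l g \<Longrightarrow> k = l" for k l
    by (cases g) auto
  then have "(\<Sum>k\<in>K. of_bool (in_layer k g)) \<le> (of_bool True :: nat)"
    by (intro sum_of_bool_le_of_bool) auto
  moreover have "length (filter (in_layer k) (g # gs)) =
      of_bool (in_layer k g) + length (filter (in_layer k) gs)" for k
    by simp
  ultimately show ?case
    using Cons by (simp only: sum.distrib list.size of_bool_eq)
qed simp

text \<open>The run is fixed before \<open>v\<close> is chosen, and by the triangle inequality each
  gate is near at most one even-parity word. Bounding by the gates of layer \<open>k\<close> alone
  lets the bounds for different \<open>k\<close> add up to the gate count.\<close>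

lemma exists_unlucky_vector:
  assumes "\<And>g. g \<in> set gs \<Longrightarrow> wf_gate d n m W g"
  shows "\<exists>v. 2 ^ (n - 1) * run_count a (nearly_fed d k (repeat_inputs d n v)) gs s
    \<le> length (filter (in_layer k) gs)"
proof -
  let ?z = "\<lambda>A. repeat_inputs d n (parity_vec n A)"
  let ?c = "\<lambda>A. run_count a (nearly_fed d k (?z A)) gs s"
  have unique: "A = B"
    if AB: "A \<in> Pow {1..<n}" "B \<in> Pow {1..<n}" and g: "g \<in> set gs"
      and near: "nearly_fed d k (?z A) g s'" "nearly_fed d k (?z B) g s'" for A B g s'
  proof (rule ccontr)
    assume "A \<noteq> B"
    obtain l i us vs where G: "g = Oracle l i us vs"
      using near by (cases g) auto
    have "length us = d * n"
      using assms(1)[OF g] G by simp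
    then have "hdist (?z A) (?z B) \<le> hdist (?z A) (map s' us) + hdist (map s' us) (?z B)"
      by (intro hdist_triangle) (simp_all add: length_repeat_inputs)
    also have "\<dots> < 2 * d"
      using near G hdist_commute[of "?z A"] by simp
    finally show False
      using hdist_parity_vec[of A n B d] AB \<open>A \<noteq> B\<close> by simp
  qed
  have layer: "nearly_fed d k z g s' \<Longrightarrow> in_layer k g" for z g s'
    by (cases g) auto
  have total: "(\<Sum>A\<in>Pow {1..<n}. ?c A) \<le> length (filter (in_layer k) gs)"
    unfolding run_count_in_layer[of a k gs s, symmetric]
    by (intro sum_run_count_le sum_of_bool_le_of_bool) (erule layer, rule unique)
  \<comment> \<open>The minimum is at most the average over the \<open>2 ^ (n - 1)\<close>
    sets.\<close>
  define A where "A = arg_min_on ?c (Pow {1..<n})"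
  have "?c A \<le> ?c B" if "B \<in> Pow {1..<n}" for B
    unfolding A_def using that by (intro arg_min_least) auto
  then have "card (Pow {1..<n}) * ?c A \<le> (\<Sum>A\<in>Pow {1..<n}. ?c A)"
    using sum_bounded_below[of "Pow {1..<n}" "?c A" ?c] by simp
  with total have "2 ^ (n - 1) * ?c A \<le> length (filter (in_layer k) gs)"
    by (simp add: card_Pow)
  then show ?thesis by blast
qed

text \<open>The secrets are fixed from the top layer downwards, each by the averaging argument
  against a run already determined.\<close>

lemma exists_unlucky_secrets:
  assumes wf: "\<And>g. g \<in> set gs \<Longrightarrow> wf_gate d n m W g"
  shows "\<exists>u. u (Suc m) = (\<lambda>_. False) \<and> (\<forall>k<m. 2 ^ (n - 1) *
      run_count (secret_oracle d n u (Suc k)) (nearly_fed d k (repeat_inputs d n (u (Suc k)))) gs s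
    \<le> length (filter (in_layer k) gs))"
proof -
  let ?P = "\<lambda>u k. 2 ^ (n - 1) *
      run_count (secret_oracle d n u (Suc k)) (nearly_fed d k (repeat_inputs d n (u (Suc k)))) gs s
    \<le> length (filter (in_layer k) gs)"
  have "\<exists>u. u (Suc m) = (\<lambda>_. False) \<and> (\<forall>k. l \<le> k \<and> k < m \<longrightarrow> ?P u k)" if "l \<le> m" for l
    using that
  proof (induction l rule: inc_induct)
    case base
    show ?case by auto
  next
    case (step l)
    then obtain u where u: "u (Suc m) = (\<lambda>_. False)" "\<And>k. Suc l \<le> k \<Longrightarrow> k < m \<Longrightarrow> ?P u k"
      by blast
    obtain v where v: "2 ^ (n - 1) *
        run_count (secret_oracle d n u (Suc l)) (nearly_fed d l (repeat_inputs d n v)) gs s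
      \<le> length (filter (in_layer l) gs)"
      using exists_unlucky_vector[OF assms, of gs "secret_oracle d n u (Suc l)" l s] by blast
    \<comment> \<open>Redefining \<open>u (Suc l)\<close> preserves every run considered so far, and
      thus the bounds already obtained.\<close>
    have same: "secret_oracle d n (u(Suc l := v)) (Suc k) = secret_oracle d n u (Suc k)"
      if "l \<le> k" for k
      using that by (intro secret_oracle_cong) auto
    have "?P (u(Suc l := v)) k" if "l \<le> k" "k < m" for k
      using that v u(2)[of k] same[of k] by (cases "k = l") auto
    then show ?case
      using u(1) step.hyps by (intro exI[of _ "u(Suc l := v)"] conjI) (simp, blast)
  qed
  from this[of 0] show ?thesis by simp
qed

section \<open>Geometric growth of the number of fed gates from layer to layer\<close>

theorem theorem29:
  fixes n m d :: nat and C :: circuit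
  assumes "d \<ge> 3" and "n \<ge> 3" and "m \<ge> 1"
    and "wf_circuit d n m C"
    and "\<And>a :: oracles. circuit_value a C = iterated_fun d n m a"
  shows "length (gates C) \<ge> min (2 ^ n) ((d - 2) ^ (m - 1))"
proof (cases "length (gates C) < 2 ^ n")
  case True
  let ?gs = "gates C" and ?s = "init C"
  have wf: "wf_gate d n m (wires C) g" if "g \<in> set ?gs" for g
    using assms(4) that by (simp add: wf_circuit_def)
  obtain u where u: "u (Suc m) = (\<lambda>_. False)"
    and unlucky: "\<And>k. k < m \<Longrightarrow> 2 ^ (n - 1) *
      run_count (secret_oracle d n u (Suc k)) (nearly_fed d k (repeat_inputs d n (u (Suc k)))) ?gs ?s
      \<le> length (filter (in_layer k) ?gs)"
    using exists_unlucky_secrets[of ?gs d n m "wires C" ?s] wf by auto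
  define N where "N k =
    run_count (secret_oracle d n u k) (fed k UNIV (repeat_inputs d n (u (Suc k)))) ?gs ?s" for k
  define L where "L k =
    run_count (secret_oracle d n u (Suc k)) (nearly_fed d k (repeat_inputs d n (u (Suc k)))) ?gs ?s"
    for k
  have "2 ^ (n - 1) * (\<Sum>k<m. L k) \<le> (\<Sum>k<m. length (filter (in_layer k) ?gs))"
    unfolding sum_distrib_left using unlucky by (intro sum_mono) (simp add: L_def)
  also have "\<dots> \<le> length ?gs"
    by (rule sum_length_filter_in_layer)
  also have "\<dots> < 2 ^ (n - 1) * 2"
    using True \<open>n \<ge> 3\<close> by (cases n) auto
  \<comment> \<open>Fewer than \<open>2 * 2 ^ (n - 1)\<close> gates force the total of lucky gates
    below 2.\<close>
  finally have few: "(\<Sum>k<m. L k) \<le> 1"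
    by simp
  \<comment> \<open>Each of the \<open>n\<close> first-layer oracles must be fed, and a gate carries
    only one index.\<close>
  have "n = (\<Sum>i\<in>{1..n}. 1)"
    by simp
  also have "\<dots> \<le> (\<Sum>i\<in>{1..n}.
      run_count (secret_oracle d n u 1) (fed 1 {i} (repeat_inputs d n (u 2))) ?gs ?s)"
    using fed_first_layer[where u = u and d = d, OF \<open>m \<ge> 1\<close> _ assms(5) u] by (intro sum_mono) auto
  also have "\<dots> \<le> N 1"
  proof -
    have "fed 1 {i} z g s \<Longrightarrow> fed 1 UNIV z g s" for i z g s
      by (cases g) auto
    moreover have "fed 1 {i} z g s \<Longrightarrow> fed 1 {j} z g s \<Longrightarrow> i = j" for i j z g s
      by (cases g) auto
    ultimately show ?thesis
      unfolding N_def numeral_2_eq_2 One_nat_def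
      by (intro sum_run_count_le sum_of_bool_le_of_bool) auto
  qed
  finally have N1: "N 1 \<ge> n" .
  \<comment> \<open>Both runs start from \<open>init C\<close>, so the initial potential is
    0.\<close>
  have step: "d * N k \<le> N (Suc k) + d * L k" for k
    using flip_balance[of ?gs d n m "wires C" u k ?s ?s] wf
    by (simp add: N_def L_def diff_wires_def)
  \<comment> \<open>The 3 comes from \<open>N 1\<close> \<ge> \<open>n\<close> \<ge> 3. A lucky gate
    of layer \<open>j\<close> \<ge> 1 costs \<open>d ^ (k - j + 1)\<close>, at most
    \<open>d ^ k\<close>.\<close>
  have grow: "3 * d ^ k \<le> N (Suc k) + (\<Sum>j\<in>{1..k}. L j) * d ^ k" for k
  proof (induction k)
    case 0
    then show ?case using N1 \<open>n \<ge> 3\<close> by simp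
  next
    case (Suc k)
    have "3 * d ^ Suc k \<le> d * N (Suc k) + (\<Sum>j\<in>{1..k}. L j) * d ^ Suc k"
      using mult_le_mono2[OF Suc, of d] by (simp add: algebra_simps)
    also have "\<dots> \<le> N (Suc (Suc k)) + d * L (Suc k) + (\<Sum>j\<in>{1..k}. L j) * d ^ Suc k"
      using step[of "Suc k"] by simp
    also have "d * L (Suc k) \<le> L (Suc k) * d ^ Suc k"
      using \<open>d \<ge> 3\<close> by simp
    finally show ?case
      by (simp add: algebra_simps)
  qed
  have "(\<Sum>j\<in>{1..m - 1}. L j) \<le> (\<Sum>k<m. L k)"
    using \<open>m \<ge> 1\<close> by (intro sum_mono2) auto
  then have "(\<Sum>j\<in>{1..m - 1}. L j) * d ^ (m - 1) \<le> 1 * d ^ (m - 1)"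
    using few by (intro mult_le_mono1) simp
  \<comment> \<open>The total loss to lucky gates is at most \<open>d ^ (m - 1)\<close> out of
    \<open>3 * d ^ (m - 1)\<close>.\<close>
  then have "d ^ (m - 1) \<le> N m"
    using grow[of "m - 1"] \<open>m \<ge> 1\<close> unfolding Suc_diff_1[OF less_le_trans[OF zero_less_one \<open>m \<ge> 1\<close>]]
    by linarith
  also have "N m \<le> length ?gs"
    unfolding N_def by (rule run_count_le_length)
  finally have "d ^ (m - 1) \<le> length ?gs" .
  moreover have "(d - 2) ^ (m - 1) \<le> d ^ (m - 1)"
    by (intro power_mono) auto
  ultimately show ?thesis by simp
qed simp

end
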